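(* Let $n\ge 2$ and $d\ge 1$ be integers, and let $u_1,\dots,u_n\in(2\mathbb{Z}_{\ge 0})^n$ be points each of whose coordinate sums equals $2d$, such that $\mathcal U=\mathrm{conv}\{u_1,\dots,u_n\}$ is an $(n-1)$-dimensional simplex (i.e. $u_1,\dots,u_n$ are affinely independent). Then for every integer $k\ge \max\{2,n-2\}$, the set $k\mathcal U\cap\mathbb{Z}^n$ is $(k\mathcal U)$-mediated.
   Context: For a simplex $\mathcal V=\mathrm{conv}\{v_1,\dots,v_n\}$ with vertices $v_i\in(2\mathbb{Z})^n$, a set $S\subseteq \mathcal V\cap\mathbb{Z}^n$ containing all vertices $v_i$ is called $\mathcal V$-mediated if every $y\in S$ either equals some vertex $v_i$, or there exist $z_1\neq z_2$ in $S\cap(2\mathbb{Z})^n$ with $y=\tfrac12(z_1+z_2)$. Here $k\mathcal U=\{ku: u\in\mathcal U\}$ is the simplex with vertices $ku_1,\dots,ku_n$. *)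

theory Defs
  imports "HOL-Analysis.Analysis"
begin

definition int_points :: "(real ^ 'n) set" where
  "int_points = {x. \<forall>j. x $ j \<in> \<int>}"

definition even_points :: "(real ^ 'n) set" where
  "even_points = {x. \<forall>j. \<exists>m::int. x $ j = 2 * of_int m}"

text \<open>Affine independence of an indexed family: \<^const>\<open>affine_dependent\<close> only sees the set of
  points, so coinciding members have to be excluded separately.\<close>

definition affinely_independent :: "('n \<Rightarrow> real ^ 'n) \<Rightarrow> bool" where
  "affinely_independent v \<longleftrightarrow> inj v \<and> \<not> affine_dependent (range v)"

text \<open>The simplex is given by its family of vertices \<open>v\<close>; the notion is meant for
  \<^term>\<open>affinely_independent v\<close> with all vertices in \<^const>\<open>even_points\<close>.\<close>

definition mediated :: "('n \<Rightarrow> real ^ 'n) \<Rightarrow> (real ^ 'n) set \<Rightarrow> bool" where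
  "mediated v S \<longleftrightarrow>
     S \<subseteq> convex hull (range v) \<inter> int_points \<and>
     range v \<subseteq> S \<and>
     (\<forall>y\<in>S. (\<exists>i. y = v i) \<or>
        (\<exists>z1\<in>S \<inter> even_points. \<exists>z2\<in>S \<inter> even_points.
           z1 \<noteq> z2 \<and> y = (1/2) *\<^sub>R (z1 + z2)))"

end

theory Submission
  imports Defs
begin

text \<open>
  Write \<open>2 y = \<Sum> \<nu>\<^sub>i u\<^sub>i\<close> with \<open>\<nu> \<ge> 0\<close> and \<open>\<Sum> \<nu>\<^sub>i = 2 k\<close>. We look for \<open>0 \<le> \<beta> \<le> \<nu>\<close> with
  \<open>\<Sum> \<beta>\<^sub>i = k\<close> such that \<open>z\<^sub>2 = \<Sum> \<beta>\<^sub>i u\<^sub>i\<close> is even; then \<open>z\<^sub>1 = 2 y - z\<^sub>2\<close> is the other point.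
  If \<open>\<Sum> \<lfloor>\<nu>\<^sub>i\<rfloor> \<ge> k\<close>, an integral \<open>\<beta>\<close> exists. Otherwise \<open>k = n - 2\<close> and the numbers
  \<open>\<gamma>\<^sub>i = \<lceil>\<nu>\<^sub>i\<rceil> - \<nu>\<^sub>i\<close> are positive with sum \<open>1\<close>. In this case
  \<open>\<beta>\<^sub>i = \<lceil>s \<gamma>\<^sub>i\<rceil> - s \<gamma>\<^sub>i\<close> works for the first \<open>s \<ge> 2\<close> such that passing from \<open>s - 1\<close> to \<open>s\<close>
  changes none of the ceilings \<open>\<lceil>s \<gamma>\<^sub>i\<rceil>\<close>.
\<close>

section \<open>Ceilings of multiples of weights with total 1\<close>

lemma sum_ceiling_less:
  fixes x :: "'n::finite \<Rightarrow> real"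
  shows "of_int (\<Sum>i\<in>UNIV. \<lceil>x i\<rceil>) < (\<Sum>i\<in>UNIV. x i) + real CARD('n)"
proof -
  have "(\<Sum>i\<in>UNIV. of_int \<lceil>x i\<rceil>) < (\<Sum>i\<in>UNIV. x i + 1)"
    by (rule sum_strict_mono) (auto, linarith)
  then show ?thesis by (simp add: sum.distrib)
qed

text \<open>With \<open>n = CARD('n)\<close>, the ceilings sum to \<open>n\<close> at
  \<open>t = 1\<close> and always to less than \<open>t + n\<close>. If every step raised some
  ceiling, their sum would have to grow by exactly one each time; but at the last multiple where the
  smallest weight is still at most 1, several ceilings jump together.\<close>

lemma stationary_ceilings_exist:
  fixes \<gamma> :: "'n::finite \<Rightarrow> real"
  assumes pos: "\<And>i. \<gamma> i > 0" and sum1: "(\<Sum>i\<in>UNIV. \<gamma> i) = 1" and card: "CARD('n) \<ge> 3"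
  shows "\<exists>t\<ge>1. (\<Sum>i\<in>UNIV. \<lceil>real t * \<gamma> i\<rceil>) = int t + int CARD('n) - 1 \<and>
           (\<forall>i. \<lceil>real (Suc t) * \<gamma> i\<rceil> = \<lceil>real t * \<gamma> i\<rceil>)"
proof (rule ccontr)
  assume neg: "\<not> ?thesis"
  define F where "F t = (\<Sum>i\<in>UNIV. \<lceil>real t * \<gamma> i\<rceil>)" for t :: nat
  have mono: "\<lceil>real t * \<gamma> i\<rceil> \<le> \<lceil>real (Suc t) * \<gamma> i\<rceil>" for t i
    using pos[of i] by (intro ceiling_mono mult_right_mono) auto
  have lt1: "\<gamma> i < 1" for i
  proof -
    have "card (UNIV - {i}) \<noteq> 0" using card by simp
    then have "UNIV - {i} \<noteq> {}" by force
    then obtain j where "j \<noteq> i" by blast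
    then have "\<gamma> i + \<gamma> j = sum \<gamma> {i, j}" by simp
    also have "\<dots> \<le> sum \<gamma> UNIV"
      by (rule sum_mono2) (use pos less_imp_le in auto)
    finally show ?thesis using sum1 pos[of j] by simp
  qed
  have F: "F t = int t + int CARD('n) - 1" if "t \<ge> 1" for t
    using that
  proof (induction t rule: nat_induct_at_least)
    case base
    have "\<lceil>\<gamma> i\<rceil> = 1" for i using pos[of i] lt1[of i] by linarith
    then show ?case by (simp add: F_def)
  next
    case (Suc t)
    obtain i where "\<lceil>real (Suc t) * \<gamma> i\<rceil> \<noteq> \<lceil>real t * \<gamma> i\<rceil>"
      using neg Suc unfolding F_def by blast
    then have "\<lceil>real t * \<gamma> i\<rceil> < \<lceil>real (Suc t) * \<gamma> i\<rceil>" using mono[of t i] by linarith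
    then have "F t < F (Suc t)"
      unfolding F_def using mono by (intro sum_strict_mono_ex1) auto
    moreover have "(\<Sum>i\<in>UNIV. real (Suc t) * \<gamma> i) = real (Suc t)"
      using sum1 by (simp flip: sum_distrib_left)
    then have "real_of_int (F (Suc t)) < real (Suc t) + real CARD('n)"
      using sum_ceiling_less[of "\<lambda>i. real (Suc t) * \<gamma> i"] unfolding F_def by simp
    then have "F (Suc t) < int (Suc t) + int CARD('n)" by linarith
    ultimately show ?case using Suc by linarith
  qed
  obtain m where "\<gamma> m = Min (range \<gamma>)"
    using Min_in[of "range \<gamma>"] by (metis UNIV_not_empty finite finite_imageI image_is_empty rangeE)
  then have m: "\<gamma> m \<le> \<gamma> i" for i by simp
  have "2 \<le> card (UNIV - {m})" using card by simp
  then obtain A where "A \<subseteq> UNIV - {m}" "card A = 2"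
    by (rule obtain_subset_with_card_n)
  then obtain a b where ab: "a \<noteq> b" "a \<noteq> m" "b \<noteq> m"
    by (auto simp: card_2_iff)
  have "3 * \<gamma> m \<le> sum \<gamma> {m, a, b}" using ab m[of a] m[of b] by simp
  also have "\<dots> \<le> sum \<gamma> UNIV"
    by (rule sum_mono2) (use pos less_imp_le in auto)
  finally have m3: "3 * \<gamma> m \<le> 1" using sum1 by simp
  \<comment> \<open>Just before \<open>T \<gamma> m\<close> passes \<open>1\<close>, the excesses of all other coordinates are so small that
    at least two ceilings have jumped simultaneously, while \<open>F\<close> grows by one only.\<close>
  define T where "T = nat \<lfloor>1 / \<gamma> m\<rfloor>"
  have "3 \<le> 1 / \<gamma> m" using m3 pos[of m] by (simp add: field_simps)
  then have T3: "T \<ge> 3" and T: "real T \<le> 1 / \<gamma> m" "1 / \<gamma> m < real T + 1"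
    unfolding T_def by linarith+
  have Tm: "real T * \<gamma> m \<le> 1" "1 < real T * \<gamma> m + \<gamma> m"
    using T pos[of m] by (simp_all add: field_simps)
  have "0 < real T * \<gamma> m" using T3 pos[of m] by simp
  then have cm: "\<lceil>real T * \<gamma> m\<rceil> = 1" using Tm by linarith
  \<comment> \<open>The excess over the largest integer strictly below
    \<open>T * \<gamma> i\<close>, so it is never zero; the formula for \<open>F T\<close> makes
    these excesses sum to exactly 1.\<close>
  define g where "g i = 1 + real T * \<gamma> i - of_int \<lceil>real T * \<gamma> i\<rceil>" for i
  have g0: "g i > 0" for i unfolding g_def by linarith
  have "sum g UNIV = real CARD('n) + real T - of_int (F T)"
    using sum1 by (simp add: g_def F_def sum.distrib sum_subtractf flip: sum_distrib_left)
  then have sg: "sum g UNIV = 1" using F[of T] T3 by simp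
  have jump: "\<lceil>real (T - 1) * \<gamma> i\<rceil> + 1 \<le> \<lceil>real T * \<gamma> i\<rceil>" if "i \<noteq> m" for i
  proof -
    have "g m + g i = sum g {m, i}" using that by simp
    also have "\<dots> \<le> sum g UNIV"
      by (rule sum_mono2) (use g0 less_imp_le in auto)
    \<comment> \<open>Since \<open>g m = T * \<gamma> m > 1 - \<gamma> m\<close>, less than
      \<open>\<gamma> m \<le> \<gamma> i\<close> remains for \<open>g i\<close>. Going back by
      \<open>\<gamma> i\<close> therefore crosses an integer.\<close>
    finally have "g i < \<gamma> i" using sg cm Tm m[of i] by (simp add: g_def[of m])
    moreover have "real (T - 1) * \<gamma> i = real T * \<gamma> i - \<gamma> i"
      using T3 by (simp add: of_nat_diff algebra_simps)
    ultimately show ?thesis unfolding g_def by linarith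
  qed
  have "F T - F (T - 1) = (\<Sum>i\<in>UNIV. \<lceil>real T * \<gamma> i\<rceil> - \<lceil>real (T - 1) * \<gamma> i\<rceil>)"
    unfolding F_def by (simp add: sum_subtractf)
  also have "\<dots> \<ge> (\<Sum>i\<in>{a, b}. \<lceil>real T * \<gamma> i\<rceil> - \<lceil>real (T - 1) * \<gamma> i\<rceil>)"
    using mono[of "T - 1"] T3 by (intro sum_mono2) auto
  finally have "F T - F (T - 1) \<ge> 2"
    using ab jump[of a] jump[of b] by simp
  then show False using F[of T] F[of "T - 1"] T3 by linarith
qed

section \<open>Splitting the coefficients into two parts of equal total\<close>

lemma exists_le_with_sum:
  fixes m :: "'n::finite \<Rightarrow> nat"
  assumes "k \<le> sum m UNIV"
  shows "\<exists>a. (\<forall>i. a i \<le> m i) \<and> sum a UNIV = k"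
  using assms
proof (induction k)
  case 0
  show ?case by (intro exI[of _ "\<lambda>_. 0"]) simp
next
  case (Suc k)
  then obtain a where a: "\<And>i. a i \<le> m i" "sum a UNIV = k" by auto
  have "\<exists>i. a i < m i"
    using Suc.prems a(2) sum_mono[of UNIV m a] by (metis not_less not_less_eq_eq)
  then obtain i where i: "a i < m i" by blast
  have "sum (\<lambda>j. a j + (if j = i then 1 else 0)) UNIV = Suc k"
    using a(2) by (simp add: sum.distrib)
  moreover have "\<forall>j. a j + (if j = i then 1 else 0) \<le> m j"
    using a(1) i by auto
  ultimately show ?case
    by (intro exI[of _ "\<lambda>j. a j + (if j = i then 1 else 0)"]) blast
qed

text \<open>The floors leave room for natural numbers with sum \<open>k\<close>. If the choice is
  exactly half of \<open>\<nu>\<close>, both ends of the segment would coincide, so one unit is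
  moved between two positive entries.\<close>

lemma integral_split:
  fixes \<nu> :: "'n::finite \<Rightarrow> real"
  assumes nn: "\<And>i. \<nu> i \<ge> 0" and "k \<ge> 1"
    and nv: "\<And>i. \<nu> i \<noteq> 2 * real k"
    and fl: "int k \<le> (\<Sum>i\<in>UNIV. \<lfloor>\<nu> i\<rfloor>)"
  shows "\<exists>a :: 'n \<Rightarrow> nat. (\<forall>i. real (a i) \<le> \<nu> i) \<and> sum a UNIV = k \<and> (\<exists>i. \<nu> i \<noteq> 2 * real (a i))"
proof -
  have "int (\<Sum>i\<in>UNIV. nat \<lfloor>\<nu> i\<rfloor>) = (\<Sum>i\<in>UNIV. \<lfloor>\<nu> i\<rfloor>)"
    using nn by simp
  then have "k \<le> (\<Sum>i\<in>UNIV. nat \<lfloor>\<nu> i\<rfloor>)" using fl by linarith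
  then obtain a where a: "\<And>i. a i \<le> nat \<lfloor>\<nu> i\<rfloor>" and sa: "sum a UNIV = k"
    using exists_le_with_sum[of k "\<lambda>i. nat \<lfloor>\<nu> i\<rfloor>"] by blast
  have al: "real (a i) \<le> \<nu> i" for i
    using a[of i] nn[of i] by linarith
  show ?thesis
  proof (cases "\<exists>i. \<nu> i \<noteq> 2 * real (a i)")
    case True
    then show ?thesis using al sa by blast
  next
    case False
    then have eq: "\<nu> i = 2 * real (a i)" for i by blast
    obtain i where i: "a i > 0"
      using sa \<open>k \<ge> 1\<close> by (metis gr0I not_one_le_zero sum.neutral)
    have si: "sum a UNIV = a i + sum a (UNIV - {i})"
      by (rule sum.remove) auto
    \<comment> \<open>Otherwise \<open>a i = k\<close>, and \<open>\<nu> i = 2 * k\<close>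
      contradicts \<open>nv\<close>.\<close>
    have "sum a (UNIV - {i}) \<noteq> 0" using si sa nv[of i] eq[of i] by linarith
    then obtain j where j: "j \<noteq> i" "a j > 0"
      by (metis DiffE gr0I insertI1 sum.neutral)
    \<comment> \<open>The raised entry still fits: \<open>a i + 1 \<le> 2 * a i = \<nu> i\<close>
      because \<open>a i > 0\<close>.\<close>
    define b where "b = a(i := a i + 1, j := a j - 1)"
    have split: "sum f UNIV = f i + (f j + sum f (UNIV - {i} - {j}))" for f :: "'n \<Rightarrow> nat"
      using j sum.remove[of UNIV i f] sum.remove[of "UNIV - {i}" j f] by simp
    have "sum b UNIV = b i + (b j + sum b (UNIV - {i} - {j}))" by (rule split)
    also have "sum b (UNIV - {i} - {j}) = sum a (UNIV - {i} - {j})"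
      by (rule sum.cong) (auto simp: b_def)
    also have "b i + (b j + \<dots>) = a i + (a j + sum a (UNIV - {i} - {j}))"
      using j by (simp add: b_def)
    also have "\<dots> = sum a UNIV" by (rule split[symmetric])
    finally have "sum b UNIV = k" using sa by simp
    moreover have "real (b l) \<le> \<nu> l" for l
      using eq[of l] i j by (auto simp: b_def)
    moreover have "\<nu> i \<noteq> 2 * real (b i)" using eq[of i] j by (simp add: b_def)
    ultimately show ?thesis by blast
  qed
qed

text \<open>The form \<open>c i + t \<nu>\<^sub>i\<close> with integral \<open>c\<close> and \<open>t\<close> makes \<open>\<Sum> \<beta>\<^sub>i u\<^sub>i\<close> an integral combination
  of the \<open>u\<^sub>i\<close> and of \<open>2 y = \<Sum> \<nu>\<^sub>i u\<^sub>i\<close>.\<close>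

lemma coefficient_split:
  fixes \<nu> :: "'n::finite \<Rightarrow> real"
  assumes nn: "\<And>i. \<nu> i \<ge> 0" and sum: "(\<Sum>i\<in>UNIV. \<nu> i) = 2 * real k"
    and k2: "k \<ge> 2" and kn: "k \<ge> CARD('n) - 2"
    and nv: "\<And>i. \<nu> i \<noteq> 2 * real k"
  shows "\<exists>(\<beta> :: 'n \<Rightarrow> real) (c :: 'n \<Rightarrow> int) (t :: int).
           (\<forall>i. 0 \<le> \<beta> i \<and> \<beta> i \<le> \<nu> i \<and> \<beta> i = of_int (c i) + of_int t * \<nu> i) \<and>
           (\<Sum>i\<in>UNIV. \<beta> i) = real k \<and> (\<exists>i. \<nu> i \<noteq> 2 * \<beta> i)"
proof (cases "int k \<le> (\<Sum>i\<in>UNIV. \<lfloor>\<nu> i\<rfloor>)")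
  case True
  then obtain a :: "'n \<Rightarrow> nat" where "\<forall>i. real (a i) \<le> \<nu> i" "sum a UNIV = k"
      "\<exists>i. \<nu> i \<noteq> 2 * real (a i)"
    using integral_split[of \<nu> k] assms by auto
  then show ?thesis
    by (intro exI[of _ "\<lambda>i. real (a i)"] exI[of _ "\<lambda>i. int (a i)"] exI[of _ 0]) auto
next
  case False
  define p where "p i = \<lfloor>\<nu> i\<rfloor>" for i
  \<comment> \<open>For integral \<open>\<nu> i\<close> this gives 1 where ceiling minus value would
    give 0, so positivity needs no case split.\<close>
  define \<gamma> where "\<gamma> i = 1 + of_int (p i) - \<nu> i" for i
  have pos: "\<gamma> i > 0" for i unfolding \<gamma>_def p_def by linarith
  have p0: "p i \<ge> 0" for i unfolding p_def using nn by simp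
  have sp: "sum p UNIV \<le> int k - 1" using False unfolding p_def by simp
  have s\<gamma>: "sum \<gamma> UNIV = real_of_int (int CARD('n) + sum p UNIV - 2 * int k)"
    using sum by (simp add: \<gamma>_def sum.distrib sum_subtractf)
  have "sum \<gamma> UNIV > 0" using pos by (intro sum_pos) auto
  \<comment> \<open>A positive integer is at least 1; together with \<open>sp\<close> and
    \<open>kn\<close> this makes all the bounds tight.\<close>
  then have "int CARD('n) + sum p UNIV - 2 * int k \<ge> 1" unfolding s\<gamma> by linarith
  then have eqs: "int CARD('n) = int k + 2" "sum p UNIV = int k - 1"
    using sp kn k2 by linarith+
  have sum1: "sum \<gamma> UNIV = 1" using s\<gamma> eqs by simp
  obtain t where t1: "t \<ge> 1"
    and tF: "(\<Sum>i\<in>UNIV. \<lceil>real t * \<gamma> i\<rceil>) = int t + int CARD('n) - 1"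
    and stat: "\<And>i. \<lceil>real (Suc t) * \<gamma> i\<rceil> = \<lceil>real t * \<gamma> i\<rceil>"
    using stationary_ceilings_exist[of \<gamma>] pos sum1 eqs k2 by force
  \<comment> \<open>The total is \<open>(t + n - 1) - (t + 1) = n - 2 = k\<close>, where
    \<open>n = CARD('n)\<close>. Stationarity allows the ceiling to be taken at \<open>t\<close>,
    which improves the bound \<open>\<beta> i < 1\<close> to \<open>1 - \<gamma> i\<close>.\<close>
  define \<beta> where "\<beta> i = of_int \<lceil>real (Suc t) * \<gamma> i\<rceil> - real (Suc t) * \<gamma> i" for i
  have b0: "\<beta> i \<ge> 0" for i unfolding \<beta>_def by linarith
  have b1: "\<beta> i < 1 - \<gamma> i" for i
    unfolding \<beta>_def stat by (simp add: algebra_simps) linarith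
  have bl: "\<beta> i < \<nu> i - of_int (p i)" for i
    using b1[of i] unfolding \<gamma>_def by linarith
  have "sum \<beta> UNIV = real_of_int (\<Sum>i\<in>UNIV. \<lceil>real t * \<gamma> i\<rceil>) - real (Suc t) * sum \<gamma> UNIV"
    unfolding \<beta>_def stat by (simp add: sum_subtractf sum_distrib_left)
  then have "sum \<beta> UNIV = real k" unfolding tF sum1 using eqs by simp
  moreover have "\<beta> i = of_int (\<lceil>real (Suc t) * \<gamma> i\<rceil> - int (Suc t) * (1 + p i))
      + of_int (int (Suc t)) * \<nu> i" for i
    unfolding \<beta>_def \<gamma>_def by (simp add: algebra_simps)
  moreover have "\<beta> i \<le> \<nu> i" for i using bl[of i] p0[of i] by simp
  moreover have "\<exists>i. \<nu> i \<noteq> 2 * \<beta> i"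
  proof -
    \<comment> \<open>As \<open>k \<ge> 2\<close>, some \<open>p i\<close> is at least 1; there
      \<open>\<beta> i < 1 \<le> p i\<close> and \<open>\<beta> i < \<nu> i - p i\<close> add up to
      \<open>2 * \<beta> i < \<nu> i\<close>.\<close>
    have "sum p UNIV \<noteq> 0" using eqs k2 by simp
    then obtain i where "p i \<noteq> 0" by (metis sum.neutral)
    then have "p i \<ge> 1" using p0[of i] by linarith
    then have "real_of_int (p i) \<ge> 1" by simp
    then have "2 * \<beta> i < \<nu> i" using bl[of i] b1[of i] pos[of i] by linarith
    then show ?thesis by (metis less_irrefl)
  qed
  ultimately show ?thesis
    using b0
    by (intro exI[of _ \<beta>] exI[of _ "\<lambda>i. \<lceil>real (Suc t) * \<gamma> i\<rceil> - int (Suc t) * (1 + p i)"]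
        exI[of _ "int (Suc t)"]) blast
qed

section \<open>Lattice arithmetic of even points\<close>

lemma even_points_add:
  assumes "x \<in> even_points" "y \<in> even_points"
  shows "x + y \<in> even_points"
proof -
  have "\<exists>m::int. (x + y) $ j = 2 * of_int m" for j
  proof -
    obtain l m :: int where "x $ j = 2 * of_int l" "y $ j = 2 * of_int m"
      using assms unfolding even_points_def by blast
    then show ?thesis by (intro exI[of _ "l + m"]) simp
  qed
  then show ?thesis unfolding even_points_def by blast
qed

lemma even_points_scale_int:
  assumes "x \<in> even_points"
  shows "of_int c *\<^sub>R x \<in> even_points"
proof -
  have "\<exists>m::int. (of_int c *\<^sub>R x) $ j = 2 * of_int m" for j
  proof -
    obtain m :: int where "x $ j = 2 * of_int m"
      using assms unfolding even_points_def by blast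
    then show ?thesis by (intro exI[of _ "c * m"]) simp
  qed
  then show ?thesis unfolding even_points_def by blast
qed

lemma zero_in_even_points: "0 \<in> even_points"
proof -
  have "(0 :: real ^ 'a) $ j = 2 * of_int 0" for j by simp
  then show ?thesis unfolding even_points_def by blast
qed

lemma even_points_sum: "(\<And>i. i \<in> A \<Longrightarrow> f i \<in> even_points) \<Longrightarrow> sum f A \<in> even_points"
proof (induction A rule: infinite_finite_induct)
  case (insert x F)
  then show ?case by (simp add: even_points_add)
qed (simp_all add: zero_in_even_points)

lemma double_int_point_even:
  assumes "y \<in> int_points"
  shows "2 *\<^sub>R y \<in> even_points"
proof -
  have "\<exists>m::int. (2 *\<^sub>R y) $ j = 2 * of_int m" for j
  proof -
    have "y $ j \<in> \<int>" using assms unfolding int_points_def by blast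
    then obtain m where "y $ j = of_int m" by (rule Ints_cases)
    then show ?thesis by (intro exI[of _ m]) simp
  qed
  then show ?thesis unfolding even_points_def by blast
qed

lemma even_points_subset_int_points: "even_points \<subseteq> int_points"
proof
  fix x :: "real ^ 'n"
  assume x: "x \<in> even_points"
  have "x $ j \<in> \<int>" for j
  proof -
    obtain m :: int where "x $ j = 2 * of_int m"
      using x unfolding even_points_def by blast
    then show ?thesis by simp
  qed
  then show "x \<in> int_points" unfolding int_points_def by blast
qed

section \<open>Barycentric coordinates and their uniqueness\<close>

lemma scaled_hull_iff:
  fixes u :: "'n::finite \<Rightarrow> 'a::real_vector"
  assumes "inj u" and "k > 0"
  shows "y \<in> (\<lambda>x. k *\<^sub>R x) ` (convex hull (range u)) \<longleftrightarrow>
    (\<exists>\<mu>. (\<forall>i. 0 \<le> \<mu> i) \<and> (\<Sum>i\<in>UNIV. \<mu> i) = k \<and> y = (\<Sum>i\<in>UNIV. \<mu> i *\<^sub>R u i))"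
proof
  assume "y \<in> (\<lambda>x. k *\<^sub>R x) ` (convex hull (range u))"
  then obtain w where w: "\<forall>x\<in>range u. 0 \<le> w x" "sum w (range u) = 1"
      "y = k *\<^sub>R (\<Sum>x\<in>range u. w x *\<^sub>R x)"
    by (auto simp: convex_hull_finite)
  have "(\<Sum>i\<in>UNIV. k * w (u i)) = k"
    using w(2) assms(1) by (simp add: sum.reindex flip: sum_distrib_left)
  moreover have "y = (\<Sum>i\<in>UNIV. (k * w (u i)) *\<^sub>R u i)"
    using w(3) assms(1) by (simp add: sum.reindex scaleR_sum_right)
  moreover have "\<forall>i. 0 \<le> k * w (u i)" using w(1) assms(2) by simp
  ultimately show "\<exists>\<mu>. (\<forall>i. 0 \<le> \<mu> i) \<and> (\<Sum>i\<in>UNIV. \<mu> i) = k \<and> y = (\<Sum>i\<in>UNIV. \<mu> i *\<^sub>R u i)"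
    by (intro exI[of _ "\<lambda>i. k * w (u i)"]) simp
next
  assume "\<exists>\<mu>. (\<forall>i. 0 \<le> \<mu> i) \<and> (\<Sum>i\<in>UNIV. \<mu> i) = k \<and> y = (\<Sum>i\<in>UNIV. \<mu> i *\<^sub>R u i)"
  then obtain \<mu> where m: "\<And>i. 0 \<le> \<mu> i" "(\<Sum>i\<in>UNIV. \<mu> i) = k" "y = (\<Sum>i\<in>UNIV. \<mu> i *\<^sub>R u i)"
    by blast
  have "(\<Sum>i\<in>UNIV. (\<mu> i / k) *\<^sub>R u i) \<in> convex hull (range u)"
    using m assms(2) by (intro convex_sum) (auto simp: hull_inc simp flip: sum_divide_distrib)
  moreover have "y = k *\<^sub>R (\<Sum>i\<in>UNIV. (\<mu> i / k) *\<^sub>R u i)"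
    using m(3) assms(2) by (simp add: scaleR_sum_right)
  ultimately show "y \<in> (\<lambda>x. k *\<^sub>R x) ` (convex hull (range u))" by blast
qed

text \<open>The \<open>u\<^sub>i\<close> lie on the hyperplane \<open>\<Sum> x\<^sub>j = s\<close>, which misses the origin, so affine
  independence amounts to linear independence.\<close>

lemma affinely_independent_coefficients_zero:
  fixes u :: "'n::finite \<Rightarrow> real ^ 'n"
  assumes ai: "affinely_independent u" and s: "\<And>i. (\<Sum>j\<in>UNIV. u i $ j) = s" "s \<noteq> 0"
    and zero: "(\<Sum>i\<in>UNIV. c i *\<^sub>R u i) = 0"
  shows "c i = 0"
proof (rule ccontr)
  assume "c i \<noteq> 0"
  have inj: "inj u" using ai unfolding affinely_independent_def by simp
  have "0 = (\<Sum>j\<in>UNIV. (\<Sum>i\<in>UNIV. c i *\<^sub>R u i) $ j)" by (simp add: zero)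
  also have "\<dots> = (\<Sum>j\<in>UNIV. \<Sum>i\<in>UNIV. c i * u i $ j)" by simp
  also have "\<dots> = (\<Sum>i\<in>UNIV. \<Sum>j\<in>UNIV. c i * u i $ j)" by (rule sum.swap)
  also have "\<dots> = (\<Sum>i\<in>UNIV. c i) * s"
    by (simp add: s(1) sum_distrib_right flip: sum_distrib_left)
  finally have c0: "(\<Sum>i\<in>UNIV. c i) = 0" using s(2) by simp
  have "affine_dependent (range u)"
    unfolding affine_dependent_explicit_finite[OF finite_imageI[OF finite_class.finite_UNIV]]
    using inj c0 zero \<open>c i \<noteq> 0\<close>
    by (intro exI[of _ "\<lambda>x. c (inv u x)"]) (auto simp: sum.reindex)
  then show False using ai unfolding affinely_independent_def by simp
qed

theorem theorem3p1:
  fixes u :: "'n::finite \<Rightarrow> real ^ 'n" and d k :: nat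
  assumes "CARD('n) \<ge> 2"
    and "d \<ge> 1"
    and "\<And>i. u i \<in> even_points"
    and "\<And>i j. u i $ j \<ge> 0"
    and "\<And>i. (\<Sum>j\<in>UNIV. u i $ j) = 2 * real d"
    and "affinely_independent u"
    and "k \<ge> max 2 (CARD('n) - 2)"
  shows "mediated (\<lambda>i. real k *\<^sub>R u i)
           ((\<lambda>x. real k *\<^sub>R x) ` (convex hull (range u)) \<inter> int_points)"
proof -
  let ?H = "(\<lambda>x. real k *\<^sub>R x) ` (convex hull (range u))"
  have inj: "inj u" using assms(6) unfolding affinely_independent_def by simp
  have k2: "k \<ge> 2" and kn: "k \<ge> CARD('n) - 2" using assms(7) by auto
  have "real k > 0" using k2 by simp
  note hull = scaled_hull_iff[OF inj \<open>real k > 0\<close>]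
  have H: "?H = convex hull (range (\<lambda>i. real k *\<^sub>R u i))"
    using convex_hull_scaling[of "real k" "range u"] by (simp add: image_image)
  have vertex: "real k *\<^sub>R u i \<in> even_points" for i
    using even_points_scale_int[OF assms(3), of "int k" i] by simp
  have main: "(\<exists>i. y = real k *\<^sub>R u i) \<or>
      (\<exists>z1\<in>?H \<inter> int_points \<inter> even_points. \<exists>z2\<in>?H \<inter> int_points \<inter> even_points.
         z1 \<noteq> z2 \<and> y = (1/2) *\<^sub>R (z1 + z2))"
    if y: "y \<in> ?H \<inter> int_points" for y
  proof (cases "\<exists>i. y = real k *\<^sub>R u i")
    case True
    then show ?thesis by blast
  next
    case nvert: False
    obtain \<mu> where \<mu>: "\<And>i. 0 \<le> \<mu> i" "(\<Sum>i\<in>UNIV. \<mu> i) = real k" "y = (\<Sum>i\<in>UNIV. \<mu> i *\<^sub>R u i)"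
      using y hull[of y] by auto
    define \<nu> where "\<nu> i = 2 * \<mu> i" for i
    have nv: "\<nu> i \<noteq> 2 * real k" for i
    proof
      assume "\<nu> i = 2 * real k"
      then have mi: "\<mu> i = real k" by (simp add: \<nu>_def)
      have "sum \<mu> (UNIV - {i}) = 0"
        using \<mu>(2) mi by (simp add: sum.remove[of UNIV i])
      then have "\<forall>j\<in>UNIV - {i}. \<mu> j = 0"
        using \<mu>(1) by (simp add: sum_nonneg_eq_0_iff)
      then have "(\<Sum>j\<in>UNIV - {i}. \<mu> j *\<^sub>R u j) = 0" by (intro sum.neutral) auto
      then have "y = real k *\<^sub>R u i"
        using \<mu>(3) mi by (simp add: sum.remove[of UNIV i])
      then show False using nvert by blast
    qed
    have "(\<Sum>i\<in>UNIV. \<nu> i) = 2 * real k"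
      using \<mu>(2) by (simp add: \<nu>_def flip: sum_distrib_left)
    moreover have "\<nu> i \<ge> 0" for i using \<mu>(1) by (simp add: \<nu>_def)
    ultimately obtain \<beta> :: "'n \<Rightarrow> real" and c :: "'n \<Rightarrow> int" and t :: int
      where b: "\<And>i. 0 \<le> \<beta> i" "\<And>i. \<beta> i \<le> \<nu> i" "\<And>i. \<beta> i = of_int (c i) + of_int t * \<nu> i"
        and sb: "(\<Sum>i\<in>UNIV. \<beta> i) = real k" and bne: "\<exists>i. \<nu> i \<noteq> 2 * \<beta> i"
      using coefficient_split[of \<nu> k] k2 kn nv by blast
    have y2: "2 *\<^sub>R y = (\<Sum>i\<in>UNIV. \<nu> i *\<^sub>R u i)"
      by (simp add: \<mu>(3) \<nu>_def scaleR_sum_right)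
    \<comment> \<open>The complementary weights are nonnegative and also have total
      \<open>2 * k - k = k\<close>.\<close>
    define z1 where "z1 = (\<Sum>i\<in>UNIV. (\<nu> i - \<beta> i) *\<^sub>R u i)"
    define z2 where "z2 = (\<Sum>i\<in>UNIV. \<beta> i *\<^sub>R u i)"
    have z12: "z1 = 2 *\<^sub>R y + of_int (-1) *\<^sub>R z2"
      unfolding y2 z1_def z2_def by (simp add: scaleR_diff_left sum_subtractf)
    have "z2 = (\<Sum>i\<in>UNIV. of_int (c i) *\<^sub>R u i) + of_int t *\<^sub>R (2 *\<^sub>R y)"
    proof -
      have "z2 = (\<Sum>i\<in>UNIV. (of_int (c i) + of_int t * \<nu> i) *\<^sub>R u i)"
        unfolding z2_def by (intro sum.cong refl arg_cong2[where f = scaleR] b(3))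
      then show ?thesis
        unfolding y2 by (simp add: scaleR_add_left sum.distrib scaleR_sum_right)
    qed
    moreover have y2e: "2 *\<^sub>R y \<in> even_points" using y double_int_point_even by blast
    ultimately have e2: "z2 \<in> even_points"
      by (simp only: even_points_add even_points_sum even_points_scale_int assms(3))
    have e1: "z1 \<in> even_points"
      unfolding z12 by (intro even_points_add even_points_scale_int y2e e2)
    have "(\<Sum>i\<in>UNIV. \<nu> i - \<beta> i) = real k"
      using \<open>(\<Sum>i\<in>UNIV. \<nu> i) = 2 * real k\<close> sb by (simp add: sum_subtractf)
    then have h1: "z1 \<in> ?H"
      unfolding hull z1_def using b(2) by (intro exI[of _ "\<lambda>i. \<nu> i - \<beta> i"]) simp
    have h2: "z2 \<in> ?H"
      unfolding hull z2_def using b(1) sb by (intro exI[of _ \<beta>]) simp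
    have "z1 \<noteq> z2"
    proof
      assume "z1 = z2"
      then have "(\<Sum>i\<in>UNIV. (\<nu> i - \<beta> i - \<beta> i) *\<^sub>R u i) = 0"
        unfolding z1_def z2_def scaleR_diff_left sum_subtractf by simp
      \<comment> \<open>This keeps the hyperplane containing the \<open>u i\<close> off the origin,
        so equal points force equal coefficients, against \<open>bne\<close>.\<close>
      moreover have "2 * real d \<noteq> 0" using assms(2) by simp
      ultimately have "\<nu> i - \<beta> i - \<beta> i = 0" for i
        by (intro affinely_independent_coefficients_zero[OF assms(6,5)])
      then have "\<nu> i = 2 * \<beta> i" for i
        by (smt (verit))
      then show False using bne by blast
    qed
    moreover have "y = (1/2) *\<^sub>R (z1 + z2)" unfolding z12 by simp
    ultimately show ?thesis
      using e1 e2 h1 h2 even_points_subset_int_points by blast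
  qed
  have "range (\<lambda>i. real k *\<^sub>R u i) \<subseteq> ?H \<inter> int_points"
    using vertex even_points_subset_int_points by (auto simp: hull_inc)
  then show ?thesis
    unfolding mediated_def using main H by blast
qed

end
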